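(* Let $\varepsilon\ge 0$ and fix $\gamma>0$. Let $\{z^t\}_{t\ge 0}$ be the sequence generated by Stochastic Amplitude Flow, $z^{t+1}=z^t-\mu_t\, g_\varepsilon(z^t)$, with an arbitrary starting point $z^0\in\mathbb C^d$ and constant step sizes $\mu_t=\mu>0$, $t\ge 0$. If the number of iterations $T\in\mathbb N$, $T\ge 1$, and the step size $\mu$ satisfy $$T\ge \frac{4[\mathcal L_\varepsilon(z^0)-\mathcal L_\varepsilon^{\inf}]}{\gamma^2\mu}\quad\text{and}\quad \mu\le\min\left\{\frac{1}{\sqrt{\alpha T}\,\|A\|},\ \frac{1}{\beta\|A\|^2},\ \frac{\gamma^2}{2\delta\|A\|^2}\right\},$$ then $$\min_{t=0,\dots,T-1}\mathbb E\|\nabla_z\mathcal L_\varepsilon(z^t)\|_2\le\gamma .$$ Furthermore, if $\mu$ is chosen precisely equal to the minimum above, then for this conclusion it is sufficient that $$T\ge\max\left\{\frac{16\,\alpha\|A\|^2[\mathcal L_\varepsilon(z^0)-\mathcal L_\varepsilon^{\inf}]^2}{\gamma^4},\ \frac{4\,\beta\|A\|^2[\mathcal L_\varepsilon(z^0)-\mathcal L_\varepsilon^{\inf}]}{\gamma^2},\ \frac{8\,\delta\|A\|^2[\mathcal L_\varepsilon(z^0)-\mathcal L_\varepsilon^{\inf}]}{\gamma^4}\right\}.$$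
   Context: Let $A\in\mathbb C^{m\times d}$ and $y\in[0,\infty)^m$ (phase retrieval measurements $y=|Ax|^2+n$ of an unknown $x\in\mathbb C^d$ with perturbation $n\in\mathbb R^m$). Functions such as $|\cdot|$, square, square root and addition of a constant act entrywise on vectors; $\circ$ and $/$ between vectors are entrywise product and division; $\operatorname{sgn}(a)=a/|a|$ for $a\ne0$ and $\operatorname{sgn}(0)=0$, applied entrywise. $\|\cdot\|$ is the spectral norm of a matrix. For $\varepsilon\ge0$ the loss is $\mathcal L_\varepsilon(z)=\|\sqrt{|Az|^2+\varepsilon}-\sqrt{y+\varepsilon}\|_2^2$, $z\in\mathbb C^d$, and $\mathcal L_\varepsilon^{\inf}=\inf_{z\in\mathbb C^d}\mathcal L_\varepsilon(z)$. Its (generalized) Wirtinger gradient is $\nabla_z\mathcal L_\varepsilon(z)=A^*(Az-\sqrt{y+\varepsilon}\circ Az/\sqrt{|Az|^2+\varepsilon})$ for $\varepsilon>0$ and $\nabla_z\mathcal L_0(z)=A^*(Az-\sqrt y\circ\operatorname{sgn}(Az))$ for $\varepsilon=0$. Partition the rows of $A$ into $R$ blocks $A_1,\dots,A_R$ ($1\le R\le m$), with $y^1,\dots,y^R$ the corresponding blocks of $y$. Let $\mathcal L_{\varepsilon,r}(z)=\|\sqrt{|A_rz|^2+\varepsilon}-\sqrt{y^r+\varepsilon}\|_2^2$, so $\mathcal L_\varepsilon=\sum_{r=1}^R\mathcal L_{\varepsilon,r}$; $\nabla_z\mathcal L_{\varepsilon,r}$ is defined by the same formulas with $(A_r,y^r)$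 in place of $(A,y)$, and $\mathcal L_{\varepsilon,r}^{\inf}=\inf_z\mathcal L_{\varepsilon,r}(z)$. Let $p$ be a probability distribution on $\{1,\dots,R\}$ with $0<p_r<1$ for all $r$ and $\sum_r p_r=1$, and let $K\in\mathbb N$, $K\ge1$. The stochastic gradient is $g_\varepsilon(z)=\frac1K\sum_{k=1}^K\frac{1}{p_{r_k}}\nabla_z\mathcal L_{\varepsilon,r_k}(z)$, where $r_1,\dots,r_K$ are drawn independently with replacement from $p$; in Stochastic Amplitude Flow fresh indices, independent of all previous ones, are drawn at every iteration $t$. Constants: $\alpha=\frac1K\max_{r}\frac{\|A_r\|^2}{p_r}$, $\beta=1-\frac1K$, $\delta=\alpha\left[\mathcal L_\varepsilon^{\inf}-\sum_{r=1}^R\mathcal L_{\varepsilon,r}^{\inf}\right]$. Fractions with zero denominator in the bound on $\mu$ are interpreted as $+\infty$. *)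

theory Defs
  imports "HOL-Probability.Probability"
begin

definition conj_transpose :: "complex ^ 'd ^ 'm \<Rightarrow> complex ^ 'm ^ 'd" where
  "conj_transpose A = (\<chi> j i. cnj (A $ i $ j))"

definition spectral_norm :: "complex ^ 'd ^ 'm \<Rightarrow> real" where
  "spectral_norm A = onorm ((*v) A)"

definition amp_loss :: "real \<Rightarrow> complex ^ 'd ^ 'm \<Rightarrow> real ^ 'm \<Rightarrow> complex ^ 'd \<Rightarrow> real" where
  "amp_loss \<epsilon> A y z =
     (norm (\<chi> i. sqrt ((cmod ((A *v z) $ i))\<^sup>2 + \<epsilon>) - sqrt (y $ i + \<epsilon>)))\<^sup>2"

definition amp_loss_inf :: "real \<Rightarrow> complex ^ 'd ^ 'm \<Rightarrow> real ^ 'm \<Rightarrow> real" where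
  "amp_loss_inf \<epsilon> A y = (INF z. amp_loss \<epsilon> A y z)"

definition wirtinger_grad ::
    "real \<Rightarrow> complex ^ 'd ^ 'm \<Rightarrow> real ^ 'm \<Rightarrow> complex ^ 'd \<Rightarrow> complex ^ 'd" where
  "wirtinger_grad \<epsilon> A y z =
     (if \<epsilon> > 0
      then conj_transpose A *v
        (\<chi> i. (A *v z) $ i
            - of_real (sqrt (y $ i + \<epsilon>)) * (A *v z) $ i
                / of_real (sqrt ((cmod ((A *v z) $ i))\<^sup>2 + \<epsilon>)))
      else conj_transpose A *v
        (\<chi> i. (A *v z) $ i - of_real (sqrt (y $ i)) * sgn ((A *v z) $ i)))"

text \<open>
  Blocks may have different numbers of rows, so they are not of a common matrix type. The block of
  a matrix or vector with row set \<open>S\<close> is represented by setting the rows outside \<open>S\<close> to zero.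
  Applied to both \<open>A\<close> and \<open>y\<close>, the padded rows contribute nothing to the loss, the gradient or the
  spectral norm, as the lemmas below confirm.
\<close>

definition row_block :: "'m set \<Rightarrow> 'a::zero ^ 'm \<Rightarrow> 'a ^ 'm" where
  "row_block S v = (\<chi> i. if i \<in> S then v $ i else 0)"

lemma row_block_mult_nth:
  fixes A :: "complex ^ 'd ^ 'm"
  shows "(row_block S A *v z) $ i = (if i \<in> S then (A *v z) $ i else 0)"
  by (simp add: row_block_def matrix_vector_mult_def)

lemma row_block_nth: "row_block S v $ i = (if i \<in> S then v $ i else 0)"
  by (simp add: row_block_def)

lemma conj_transpose_mult_nth:
  "(conj_transpose A *v w) $ j = (\<Sum>i\<in>UNIV. cnj (A $ i $ j) * w $ i)"
  by (simp add: conj_transpose_def matrix_vector_mult_def)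

lemma amp_loss_eq_sum:
  "amp_loss \<epsilon> A y z =
     (\<Sum>i\<in>UNIV. (sqrt ((cmod ((A *v z) $ i))\<^sup>2 + \<epsilon>) - sqrt (y $ i + \<epsilon>))\<^sup>2)"
  by (simp add: amp_loss_def norm_vec_def L2_set_def sum_nonneg)

lemma amp_loss_row_block:
  "amp_loss \<epsilon> (row_block S A) (row_block S y) z =
     (\<Sum>i\<in>S. (sqrt ((cmod ((A *v z) $ i))\<^sup>2 + \<epsilon>) - sqrt (y $ i + \<epsilon>))\<^sup>2)"
proof -
  have "amp_loss \<epsilon> (row_block S A) (row_block S y) z =
      (\<Sum>i\<in>UNIV. if i \<in> S
         then (sqrt ((cmod ((A *v z) $ i))\<^sup>2 + \<epsilon>) - sqrt (y $ i + \<epsilon>))\<^sup>2 else 0)"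
    unfolding amp_loss_eq_sum row_block_mult_nth
    by (intro sum.cong) (auto simp: row_block_def)
  then show ?thesis
    by (simp add: sum.If_cases)
qed

lemma wirtinger_grad_row_block_nth:
  "wirtinger_grad \<epsilon> (row_block S A) (row_block S y) z $ j =
     (\<Sum>i\<in>S. cnj (A $ i $ j) *
        (if \<epsilon> > 0
         then (A *v z) $ i - of_real (sqrt (y $ i + \<epsilon>)) * (A *v z) $ i
                / of_real (sqrt ((cmod ((A *v z) $ i))\<^sup>2 + \<epsilon>))
         else (A *v z) $ i - of_real (sqrt (y $ i)) * sgn ((A *v z) $ i)))"
    (is "_ = (\<Sum>i\<in>S. ?f i)")
proof -
  have "wirtinger_grad \<epsilon> (row_block S A) (row_block S y) z $ j =
      (\<Sum>i\<in>UNIV. if i \<in> S then ?f i else 0)"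
    unfolding wirtinger_grad_def
    by (auto simp: conj_transpose_mult_nth row_block_mult_nth row_block_nth intro!: sum.cong)
  then show ?thesis
    by (simp add: sum.If_cases)
qed

lemma spectral_norm_row_block:
  "spectral_norm (row_block S A) = (SUP z. L2_set (\<lambda>i. cmod ((A *v z) $ i)) S / norm z)"
proof -
  have "norm (row_block S A *v z) = L2_set (\<lambda>i. cmod ((A *v z) $ i)) S" for z
  proof -
    have "(\<Sum>i\<in>UNIV. (cmod ((row_block S A *v z) $ i))\<^sup>2) =
        (\<Sum>i\<in>UNIV. if i \<in> S then (cmod ((A *v z) $ i))\<^sup>2 else 0)"
      by (intro sum.cong) (auto simp: row_block_mult_nth)
    also have "\<dots> = (\<Sum>i\<in>S. (cmod ((A *v z) $ i))\<^sup>2)"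
      by (simp add: sum.If_cases)
    finally show ?thesis
      by (simp add: norm_vec_def L2_set_def)
  qed
  then show ?thesis
    by (simp add: spectral_norm_def onorm_def)
qed

text \<open>
  In the following, \<open>B r\<close> is the set of rows of block \<open>r\<close>, for \<open>r = 1, \<dots>, R\<close>, and \<open>r k\<close> is the
  index drawn in position \<open>k\<close> of the minibatch.
\<close>

definition stoch_grad ::
    "real \<Rightarrow> complex ^ 'd ^ 'm \<Rightarrow> real ^ 'm \<Rightarrow> (nat \<Rightarrow> 'm set) \<Rightarrow> nat pmf \<Rightarrow> nat
      \<Rightarrow> (nat \<Rightarrow> nat) \<Rightarrow> complex ^ 'd \<Rightarrow> complex ^ 'd" where
  "stoch_grad \<epsilon> A y B p K r z =
     (1 / real K) *\<^sub>R (\<Sum>k\<in>{1..K}.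
        (1 / pmf p (r k)) *\<^sub>R
          wirtinger_grad \<epsilon> (row_block (B (r k)) A) (row_block (B (r k)) y) z)"

definition saf_alpha ::
    "complex ^ 'd ^ 'm \<Rightarrow> (nat \<Rightarrow> 'm set) \<Rightarrow> nat \<Rightarrow> nat pmf \<Rightarrow> nat \<Rightarrow> real" where
  "saf_alpha A B R p K =
     1 / real K * (MAX r\<in>{1..R}. (spectral_norm (row_block (B r) A))\<^sup>2 / pmf p r)"

definition saf_beta :: "nat \<Rightarrow> real" where
  "saf_beta K = 1 - 1 / real K"

definition saf_delta ::
    "real \<Rightarrow> complex ^ 'd ^ 'm \<Rightarrow> real ^ 'm \<Rightarrow> (nat \<Rightarrow> 'm set) \<Rightarrow> nat \<Rightarrow> nat pmf \<Rightarrow> nat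
      \<Rightarrow> real" where
  "saf_delta \<epsilon> A y B R p K =
     saf_alpha A B R p K *
       (amp_loss_inf \<epsilon> A y
        - (\<Sum>r\<in>{1..R}. amp_loss_inf \<epsilon> (row_block (B r) A) (row_block (B r) y)))"

text \<open>
  The bound on the step size is extended-real valued: there, a positive number divided by zero is
  \<open>\<infinity>\<close>, whereas it is \<open>0\<close> on the reals.
\<close>

definition saf_step_bound ::
    "real \<Rightarrow> complex ^ 'd ^ 'm \<Rightarrow> real ^ 'm \<Rightarrow> (nat \<Rightarrow> 'm set) \<Rightarrow> nat \<Rightarrow> nat pmf \<Rightarrow> nat
      \<Rightarrow> real \<Rightarrow> nat \<Rightarrow> ereal" where
  "saf_step_bound \<epsilon> A y B R p K \<gamma> T =
     Min {ereal 1 / ereal (sqrt (saf_alpha A B R p K * real T) * spectral_norm A),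
          ereal 1 / ereal (saf_beta K * (spectral_norm A)\<^sup>2),
          ereal (\<gamma>\<^sup>2) / ereal (2 * saf_delta \<epsilon> A y B R p K * (spectral_norm A)\<^sup>2)}"

lemma ereal_divide_zero: "0 < a \<Longrightarrow> ereal a / ereal 0 = \<infinity>"
  by (simp add: divide_ereal_def)

end

theory Submission
  imports Defs
begin

text \<open>
  Two inequalities about a single loss carry the proof. Writing the squared residual
  \<open>(sqrt (|u|\<^sup>2 + \<epsilon>) - b)\<^sup>2\<close> as \<open>|u|\<^sup>2 - 2 * b * sqrt (|u|\<^sup>2 + \<epsilon>)\<close> plus a constant, its only
  non-quadratic part is concave for \<open>b \<ge> 0\<close>, so replacing that part by a tangent bounds the loss from
  above. The tangent slope is the generalized Wirtinger gradient, also at the points where the loss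
  for \<open>\<epsilon> = 0\<close> is not differentiable. This is the descent lemma \<open>amp_loss_descent\<close>, with curvature
  \<open>\<parallel>A\<parallel>\<^sup>2\<close>. Taking one exact gradient step in it gives \<open>\<parallel>\<nabla>L\<parallel>\<^sup>2 \<le> \<parallel>A\<parallel>\<^sup>2 * (L - L\<^sup>i\<^sup>n\<^sup>f)\<close>
  (\<open>norm_wirtinger_grad_square_le\<close>), which holds for every block as well.

  The stochastic gradient is a mean of \<open>K\<close> independent importance-weighted block gradients. It is
  therefore unbiased, and its second moment is \<open>1 / K\<close> times that of a single draw plus \<open>\<beta>\<close> times
  \<open>\<parallel>\<nabla>L\<parallel>\<^sup>2\<close>. The gradient inequality on the blocks bounds the first part by
  \<open>\<alpha> * (L - L\<^sup>i\<^sup>n\<^sup>f) + \<delta>\<close>. Inserted in the descent lemma, with \<open>\<mu> * \<beta> * \<parallel>A\<parallel>\<^sup>2 \<le> 1\<close> absorbing the \<open>\<beta>\<close>-term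
  in half of the linear decrease, this yields for \<open>D t = E (L (z t)) - L\<^sup>i\<^sup>n\<^sup>f\<close> the recursion
  \<open>D (t + 1) \<le> (1 + \<mu>\<^sup>2 * \<alpha> * \<parallel>A\<parallel>\<^sup>2) * D t - \<mu> * E \<parallel>\<nabla>L (z t)\<parallel>\<^sup>2 + \<mu>\<^sup>2 * \<parallel>A\<parallel>\<^sup>2 * \<delta>\<close>
  (\<open>expected_excess_loss_recursion\<close>).

  The growth factor \<open>1 + a\<close> has \<open>a * T \<le> 1\<close>, so the discounted sum of \<open>T\<close> steps is still at least
  \<open>T / 2\<close> (\<open>geometric_sum_ge_half\<close>). Hence the smallest \<open>E \<parallel>\<nabla>L (z t)\<parallel>\<^sup>2\<close> is at most
  \<open>2 * D 0 / (\<mu> * T) + \<mu> * \<parallel>A\<parallel>\<^sup>2 * \<delta>\<close>. The condition on \<open>T\<close> makes the first summand at most \<open>\<gamma>\<^sup>2 / 2\<close>,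
  the third bound on \<open>\<mu>\<close> does the same for the second, and \<open>(E X)\<^sup>2 \<le> E (X\<^sup>2)\<close> finishes the argument.

  Since the index law has finite support, \<open>z t\<close> takes finitely many values almost surely. Its law is
  that of a Markov chain of probability mass functions (\<open>expectation_driven_process\<close>), so that
  conditioning on the past becomes a monadic bind and every function is integrable.
\<close>

section \<open>Geometry of the amplitude loss\<close>

text \<open>
  The function \<open>u \<mapsto> sqrt (|u|\<^sup>2 + \<epsilon>)\<close> is the norm of the pair \<open>(u, sqrt \<epsilon>)\<close>, so this tangent
  bound is the Cauchy-Schwarz inequality for two such pairs. For \<open>u = 0\<close> and \<open>\<epsilon> = 0\<close> the convention
  \<open>x / 0 = 0\<close> selects the subgradient zero.
\<close>

lemma sqrt_norm_square_subgradient: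
  fixes u v :: "'a::real_inner"
  assumes "0 \<le> \<epsilon>"
  shows "sqrt ((norm u)\<^sup>2 + \<epsilon>) + (u \<bullet> v) / sqrt ((norm u)\<^sup>2 + \<epsilon>) \<le> sqrt ((norm (u + v))\<^sup>2 + \<epsilon>)"
proof (cases "sqrt ((norm u)\<^sup>2 + \<epsilon>) = 0")
  case True
  then show ?thesis using assms by simp
next
  case False
  define s where "s = sqrt ((norm u)\<^sup>2 + \<epsilon>)"
  define s' where "s' = sqrt ((norm (u + v))\<^sup>2 + \<epsilon>)"
  have s: "s > 0" using False assms by (simp add: s_def less_le)
  have "(u, sqrt \<epsilon>) \<bullet> (u + v, sqrt \<epsilon>) \<le> norm (u, sqrt \<epsilon>) * norm (u + v, sqrt \<epsilon>)"
    by (rule norm_cauchy_schwarz)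
  also have "\<dots> = s * s'" using assms by (simp add: norm_Pair s_def s'_def)
  finally have "(norm u)\<^sup>2 + \<epsilon> + u \<bullet> v \<le> s * s'"
    using assms by (simp add: inner_add_right power2_norm_eq_inner)
  moreover have "(norm u)\<^sup>2 + \<epsilon> = s * s" using assms by (simp add: s_def)
  ultimately have "s * (s + (u \<bullet> v) / s) \<le> s * s'" using s by (simp add: algebra_simps)
  then have "s + (u \<bullet> v) / s \<le> s'" using s by simp
  then show ?thesis by (simp add: s_def s'_def)
qed

text \<open>
  After expanding the squares, the quadratic terms agree exactly on both sides; what remains is the
  subgradient inequality multiplied by \<open>- 2 * b\<close>, whence the sign condition on \<open>b\<close>.
\<close>

lemma amplitude_residual_square_upper_model:
  fixes u v :: "'a::real_inner"
  assumes "0 \<le> \<epsilon>" "0 \<le> b"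
  shows "(sqrt ((norm (u + v))\<^sup>2 + \<epsilon>) - b)\<^sup>2
    \<le> (sqrt ((norm u)\<^sup>2 + \<epsilon>) - b)\<^sup>2
      + 2 * ((u - (b / sqrt ((norm u)\<^sup>2 + \<epsilon>)) *\<^sub>R u) \<bullet> v) + (norm v)\<^sup>2"
proof -
  define s where "s = sqrt ((norm u)\<^sup>2 + \<epsilon>)"
  define s' where "s' = sqrt ((norm (u + v))\<^sup>2 + \<epsilon>)"
  have "s\<^sup>2 = (norm u)\<^sup>2 + \<epsilon>" "s'\<^sup>2 = (norm (u + v))\<^sup>2 + \<epsilon>"
    using assms(1) by (simp_all add: s_def s'_def)
  then have s2: "s\<^sup>2 = u \<bullet> u + \<epsilon>" and s'2: "s'\<^sup>2 = u \<bullet> u + 2 * (u \<bullet> v) + v \<bullet> v + \<epsilon>"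
    by (simp_all add: power2_norm_eq_inner inner_add_left inner_add_right inner_commute)
  have "2 * b * (s + (u \<bullet> v) / s) \<le> 2 * b * s'"
    using sqrt_norm_square_subgradient[OF assms(1), of u v] assms(2)
    by (intro mult_left_mono) (auto simp: s_def s'_def)
  then have "s'\<^sup>2 - 2 * b * s' + b\<^sup>2 \<le> s\<^sup>2 - 2 * b * s + b\<^sup>2
      + 2 * ((u - (b / s) *\<^sub>R u) \<bullet> v) + (norm v)\<^sup>2"
    unfolding s2 s'2 by (simp add: power2_norm_eq_inner inner_diff_left algebra_simps)
  then show ?thesis
    unfolding s_def[symmetric] s'_def[symmetric] by (simp add: power2_eq_square algebra_simps)
qed

text \<open>
  The inner product is the real one, that is, the real part of the Hermitian form. Real
  directional derivatives of the loss are expressed with it.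
\<close>

lemma inner_conj_transpose:
  fixes A :: "complex ^ 'd ^ 'm"
  shows "(conj_transpose A *v w) \<bullet> h = w \<bullet> (A *v h)"
proof -
  have "(conj_transpose A *v w) \<bullet> h
      = (\<Sum>j\<in>UNIV. \<Sum>i\<in>UNIV. (cnj (A $ i $ j) * w $ i) \<bullet> h $ j)"
    by (simp add: inner_vec_def conj_transpose_mult_nth inner_sum_left)
  also have "\<dots> = (\<Sum>i\<in>UNIV. \<Sum>j\<in>UNIV. w $ i \<bullet> (A $ i $ j * h $ j))"
    by (subst sum.swap) (intro sum.cong refl, simp add: inner_complex_def algebra_simps)
  also have "\<dots> = w \<bullet> (A *v h)"
    by (simp add: inner_vec_def matrix_vector_mult_def inner_sum_right)
  finally show ?thesis .
qed

lemma spectral_norm_nonneg: "0 \<le> spectral_norm (A :: complex ^ 'd ^ 'm)"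
  unfolding spectral_norm_def by (rule onorm_pos_le) (rule matrix_vector_mul_bounded_linear)

lemma norm_mult_vec_le: "norm (A *v h) \<le> spectral_norm A * norm (h :: complex ^ 'd)"
  unfolding spectral_norm_def by (rule onorm) (rule matrix_vector_mul_bounded_linear)

text \<open>
  With \<open>x / 0 = 0\<close>, the formula for \<open>\<epsilon> > 0\<close> turns into the one with \<open>sgn\<close> at \<open>\<epsilon> = 0\<close>, so that the two
  cases of the gradient can be treated together.
\<close>

lemma wirtinger_grad_eq:
  fixes A :: "complex ^ 'd ^ 'm"
  assumes "0 \<le> \<epsilon>"
  shows "wirtinger_grad \<epsilon> A y z = conj_transpose A *v
    (\<chi> i. (A *v z) $ i
        - (sqrt (y $ i + \<epsilon>) / sqrt ((cmod ((A *v z) $ i))\<^sup>2 + \<epsilon>)) *\<^sub>R (A *v z) $ i)"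
proof (cases "\<epsilon> > 0")
  case True
  then show ?thesis by (simp add: wirtinger_grad_def scaleR_conv_of_real)
next
  case False
  then have "\<epsilon> = 0" using assms by simp
  then show ?thesis by (simp add: wirtinger_grad_def sgn_div_norm scaleR_conv_of_real divide_inverse mult.assoc)
qed

text \<open>
  The scalar upper model is summed over the rows, with increments \<open>(A *v h) $ i\<close>. The factor \<open>2\<close>
  appears because the real gradient is twice the Wirtinger gradient.
\<close>

lemma amp_loss_descent:
  fixes A :: "complex ^ 'd ^ 'm"
  assumes "0 \<le> \<epsilon>" "\<And>i. 0 \<le> y $ i"
  shows "amp_loss \<epsilon> A y (z + h)
    \<le> amp_loss \<epsilon> A y z + 2 * (wirtinger_grad \<epsilon> A y z \<bullet> h) + (spectral_norm A)\<^sup>2 * (norm h)\<^sup>2"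
proof -
  define w where "w = (\<chi> i. (A *v z) $ i
      - (sqrt (y $ i + \<epsilon>) / sqrt ((cmod ((A *v z) $ i))\<^sup>2 + \<epsilon>)) *\<^sub>R (A *v z) $ i)"
  have "amp_loss \<epsilon> A y (z + h)
      \<le> (\<Sum>i\<in>UNIV. (sqrt ((cmod ((A *v z) $ i))\<^sup>2 + \<epsilon>) - sqrt (y $ i + \<epsilon>))\<^sup>2
        + 2 * (w $ i \<bullet> (A *v h) $ i) + (cmod ((A *v h) $ i))\<^sup>2)"
    unfolding amp_loss_eq_sum matrix_vector_right_distrib vector_add_component w_def vec_lambda_beta
    using assms by (intro sum_mono amplitude_residual_square_upper_model) auto
  also have "\<dots> = amp_loss \<epsilon> A y z + 2 * (w \<bullet> (A *v h)) + (norm (A *v h))\<^sup>2"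
    by (simp add: amp_loss_eq_sum sum.distrib inner_vec_def sum_distrib_left norm_vec_def
        L2_set_def sum_nonneg)
  also have "w \<bullet> (A *v h) = wirtinger_grad \<epsilon> A y z \<bullet> h"
    by (simp add: wirtinger_grad_eq[OF assms(1)] inner_conj_transpose w_def)
  also have "(norm (A *v h))\<^sup>2 \<le> (spectral_norm A)\<^sup>2 * (norm h)\<^sup>2"
    using power_mono[OF norm_mult_vec_le[of A h], of 2] by (simp add: power_mult_distrib)
  finally show ?thesis by simp
qed

lemma amp_loss_nonneg: "0 \<le> amp_loss \<epsilon> A y z"
  by (simp add: amp_loss_def)

lemma amp_loss_inf_le: "amp_loss_inf \<epsilon> A y \<le> amp_loss \<epsilon> A y z"
  unfolding amp_loss_inf_def by (rule cINF_lower) (auto intro: bdd_belowI2 amp_loss_nonneg)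

text \<open>
  No point has loss below the infimum, in particular not the point reached by the step
  \<open>- \<nabla>L / \<parallel>A\<parallel>\<^sup>2\<close>, which minimizes the quadratic upper bound of the descent lemma.
\<close>

lemma norm_wirtinger_grad_square_le:
  fixes A :: "complex ^ 'd ^ 'm"
  assumes "0 \<le> \<epsilon>" "\<And>i. 0 \<le> y $ i"
  shows "(norm (wirtinger_grad \<epsilon> A y z))\<^sup>2
    \<le> (spectral_norm A)\<^sup>2 * (amp_loss \<epsilon> A y z - amp_loss_inf \<epsilon> A y)"
proof (cases "spectral_norm A = 0")
  case True
  have "(norm (wirtinger_grad \<epsilon> A y z))\<^sup>2 = 0"
  proof -
    have "A *v h = 0" for h using norm_mult_vec_le[of A h] True by simp
    then have "wirtinger_grad \<epsilon> A y z \<bullet> wirtinger_grad \<epsilon> A y z = 0"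
      by (simp add: wirtinger_grad_eq[OF assms(1)] inner_conj_transpose)
    then show ?thesis by simp
  qed
  then show ?thesis using True by simp
next
  case False
  define N where "N = (spectral_norm A)\<^sup>2"
  define g where "g = wirtinger_grad \<epsilon> A y z"
  have N: "N > 0" using False by (simp add: N_def)
  have "amp_loss_inf \<epsilon> A y \<le> amp_loss \<epsilon> A y (z + (- (1 / N)) *\<^sub>R g)"
    by (rule amp_loss_inf_le)
  also have "\<dots> \<le> amp_loss \<epsilon> A y z + 2 * (g \<bullet> ((- (1 / N)) *\<^sub>R g))
      + N * (norm ((- (1 / N)) *\<^sub>R g))\<^sup>2"
    unfolding g_def N_def by (rule amp_loss_descent[OF assms])
  also have "\<dots> = amp_loss \<epsilon> A y z - (norm g)\<^sup>2 / N"
    using N by (simp add: power2_norm_eq_inner[symmetric] power_mult_distrib field_simps power2_eq_square)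
  finally have "(norm g)\<^sup>2 / N \<le> amp_loss \<epsilon> A y z - amp_loss_inf \<epsilon> A y" by simp
  then show ?thesis using N by (simp add: g_def N_def[symmetric] field_simps)
qed

section \<open>Splitting the loss into blocks\<close>

lemma row_block_UNIV: "row_block UNIV v = v"
  by (simp add: row_block_def vec_eq_iff)

lemma sum_partition_UNIV:
  fixes f :: "'i::finite \<Rightarrow> 'b::comm_monoid_add"
  assumes "finite I" "disjoint_family_on B I" "(\<Union>r\<in>I. B r) = UNIV"
  shows "(\<Sum>r\<in>I. \<Sum>i\<in>B r. f i) = (\<Sum>i\<in>UNIV. f i)"
  unfolding assms(3)[symmetric]
  using assms(1,2) by (intro sum.UNION_disjoint[symmetric]) (auto simp: disjoint_family_on_def)

lemma sum_amp_loss_row_block: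
  fixes A :: "complex ^ 'd ^ 'm"
  assumes "finite I" "disjoint_family_on B I" "(\<Union>r\<in>I. B r) = UNIV"
  shows "(\<Sum>r\<in>I. amp_loss \<epsilon> (row_block (B r) A) (row_block (B r) y) z) = amp_loss \<epsilon> A y z"
  unfolding amp_loss_row_block amp_loss_eq_sum[of \<epsilon> A] by (rule sum_partition_UNIV[OF assms])

lemma sum_wirtinger_grad_row_block:
  fixes A :: "complex ^ 'd ^ 'm"
  assumes "finite I" "disjoint_family_on B I" "(\<Union>r\<in>I. B r) = UNIV"
  shows "(\<Sum>r\<in>I. wirtinger_grad \<epsilon> (row_block (B r) A) (row_block (B r) y) z)
    = wirtinger_grad \<epsilon> A y z"
proof (rule vec_eq_iff[THEN iffD2], intro allI)
  fix j
  show "(\<Sum>r\<in>I. wirtinger_grad \<epsilon> (row_block (B r) A) (row_block (B r) y) z) $ j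
      = wirtinger_grad \<epsilon> A y z $ j"
    using wirtinger_grad_row_block_nth[of \<epsilon> UNIV A y z j]
    unfolding sum_component wirtinger_grad_row_block_nth sum_partition_UNIV[OF assms]
      row_block_UNIV by simp
qed

text \<open>
  Minimizing every block loss separately can only do better than a common minimizer; this is what
  makes \<open>\<delta>\<close> nonnegative.
\<close>

lemma sum_amp_loss_inf_row_block_le:
  fixes A :: "complex ^ 'd ^ 'm"
  assumes "finite I" "disjoint_family_on B I" "(\<Union>r\<in>I. B r) = UNIV"
  shows "(\<Sum>r\<in>I. amp_loss_inf \<epsilon> (row_block (B r) A) (row_block (B r) y)) \<le> amp_loss_inf \<epsilon> A y"
  unfolding amp_loss_inf_def[of \<epsilon> A]
proof (rule cINF_greatest)
  fix z
  show "(\<Sum>r\<in>I. amp_loss_inf \<epsilon> (row_block (B r) A) (row_block (B r) y)) \<le> amp_loss \<epsilon> A y z"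
    by (subst sum_amp_loss_row_block[OF assms, symmetric]) (intro sum_mono amp_loss_inf_le)
qed simp

section \<open>Expectations over finitely supported mass functions\<close>

lemma expectation_bind_finite:
  fixes h :: "'b \<Rightarrow> 'c::{banach, second_countable_topology}"
  assumes "finite (set_pmf p)" "\<And>x. x \<in> set_pmf p \<Longrightarrow> finite (set_pmf (f x))"
  shows "measure_pmf.expectation (bind_pmf p f) h
    = measure_pmf.expectation p (\<lambda>x. measure_pmf.expectation (f x) h)"
  by (subst pmf_expectation_bind[OF assms(1)])
    (use assms in \<open>auto simp: integral_measure_pmf[OF assms(1)]\<close>)

lemma expectation_pair_finite:
  fixes h :: "'a \<times> 'b \<Rightarrow> 'c::{banach, second_countable_topology}"
  assumes "finite (set_pmf p)" "finite (set_pmf q)"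
  shows "measure_pmf.expectation (pair_pmf p q) h
    = measure_pmf.expectation p (\<lambda>x. measure_pmf.expectation q (\<lambda>y. h (x, y)))"
  using assms by (simp add: pair_pmf_def expectation_bind_finite)

lemma finite_set_Pi_pmf:
  assumes "finite J" "\<And>j. j \<in> J \<Longrightarrow> finite (set_pmf (p j))"
  shows "finite (set_pmf (Pi_pmf J d p))"
  unfolding set_Pi_pmf[OF assms(1)] using assms by (intro finite_PiE_dflt) auto

lemma expectation_Pi_pmf_insert:
  fixes f :: "('i \<Rightarrow> 'a) \<Rightarrow> 'b::{banach, second_countable_topology}"
  assumes "finite J" "i \<notin> J" "\<And>j. j \<in> insert i J \<Longrightarrow> finite (set_pmf (p j))"
  shows "measure_pmf.expectation (Pi_pmf (insert i J) d p) f
    = measure_pmf.expectation (p i)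
        (\<lambda>a. measure_pmf.expectation (Pi_pmf J d p) (\<lambda>x. f (x(i := a))))"
  using assms by (simp add: Pi_pmf_insert case_prod_unfold expectation_pair_finite finite_set_Pi_pmf)

lemma expectation_sum_Pi_pmf:
  fixes h :: "'a \<Rightarrow> 'v::euclidean_space"
  assumes fin: "finite (set_pmf p)" and J: "finite J"
  defines "m \<equiv> measure_pmf.expectation p h"
  shows "measure_pmf.expectation (Pi_pmf J d (\<lambda>_. p)) (\<lambda>x. \<Sum>k\<in>J. h (x k)) = real (card J) *\<^sub>R m"
  using J
proof (induction J rule: finite_induct)
  case empty
  then show ?case by simp
next
  case (insert i J)
  have I[simp]: "integrable (measure_pmf p) g" for g :: "'a \<Rightarrow> 'v"
    by (rule integrable_measure_pmf_finite[OF fin])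
  have I'[simp]: "integrable (measure_pmf (Pi_pmf J d (\<lambda>_. p))) g" for g :: "('b \<Rightarrow> 'a) \<Rightarrow> 'v"
    using fin insert by (intro integrable_measure_pmf_finite finite_set_Pi_pmf) auto
  have "(\<Sum>k\<in>insert i J. h ((x(i := a)) k)) = h a + (\<Sum>k\<in>J. h (x k))" for x a
    using insert by (auto intro!: sum.cong)
  then show ?case
    using insert fin
    by (simp add: expectation_Pi_pmf_insert measure_pmf.prob_space m_def algebra_simps)
qed

text \<open>
  Independent draws contribute their second moments on the diagonal and inner products of means off
  the diagonal. Adding one draw at a time, the cross term is \<open>2 * (m \<bullet> (|J| * m))\<close>, which accounts for
  the increase of \<open>|J| * (|J| - 1)\<close>.
\<close>

lemma expectation_norm_square_sum_Pi_pmf: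
  fixes h :: "'a \<Rightarrow> 'v::euclidean_space"
  assumes fin: "finite (set_pmf p)" and J: "finite J"
  defines "m \<equiv> measure_pmf.expectation p h"
    and "V \<equiv> measure_pmf.expectation p (\<lambda>a. (norm (h a))\<^sup>2)"
  shows "measure_pmf.expectation (Pi_pmf J d (\<lambda>_. p)) (\<lambda>x. (norm (\<Sum>k\<in>J. h (x k)))\<^sup>2)
    = real (card J) * V + real (card J) * (real (card J) - 1) * (norm m)\<^sup>2"
  using J
proof (induction J rule: finite_induct)
  case empty
  then show ?case by simp
next
  case (insert i J)
  define Q where "Q = Pi_pmf J d (\<lambda>_. p)"
  define S where "S = (\<lambda>x. \<Sum>k\<in>J. h (x k))"
  have I[simp]: "integrable (measure_pmf p) g" for g :: "'a \<Rightarrow> 'w::euclidean_space"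
    by (rule integrable_measure_pmf_finite[OF fin])
  have I'[simp]: "integrable (measure_pmf Q) g" for g :: "('b \<Rightarrow> 'a) \<Rightarrow> 'w::euclidean_space"
    unfolding Q_def using fin insert by (intro integrable_measure_pmf_finite finite_set_Pi_pmf) auto
  have "(norm (\<Sum>k\<in>insert i J. h ((x(i := a)) k)))\<^sup>2
      = (norm (h a))\<^sup>2 + 2 * (h a \<bullet> S x) + (norm (S x))\<^sup>2" for x a
  proof -
    have "(\<Sum>k\<in>insert i J. h ((x(i := a)) k)) = h a + S x"
      using insert by (auto simp: S_def intro!: sum.cong)
    then show ?thesis
      by (simp add: power2_norm_eq_inner inner_add_left inner_add_right inner_commute)
  qed
  then have "measure_pmf.expectation (Pi_pmf (insert i J) d (\<lambda>_. p))
        (\<lambda>x. (norm (\<Sum>k\<in>insert i J. h (x k)))\<^sup>2)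
      = V + 2 * (m \<bullet> measure_pmf.expectation Q S)
        + measure_pmf.expectation Q (\<lambda>x. (norm (S x))\<^sup>2)"
    using insert fin
    by (simp add: expectation_Pi_pmf_insert Q_def[symmetric] V_def m_def)
  then show ?case
    using insert expectation_sum_Pi_pmf[OF fin insert(1), of d h]
    by (simp add: Q_def S_def m_def power2_norm_eq_inner algebra_simps)
qed

section \<open>The joint law of independent discrete variables\<close>

text \<open>
  Both measures live on the countable set of functions that equal \<open>d\<close> off \<open>J\<close>, so it suffices to
  compare the masses of single functions; independence turns these into products. The default value
  \<open>d\<close> makes the tuple a function on the whole index type, as product mass functions require.
\<close>

lemma (in prob_space) distr_indep_vars_eq_Pi_pmf:
  fixes X :: "'i \<Rightarrow> 'a \<Rightarrow> 'b::countable" and d :: 'b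
  assumes J: "finite J" and indep: "indep_vars (\<lambda>_. count_space UNIV) X J"
    and law: "\<And>j. j \<in> J \<Longrightarrow> distr M (count_space UNIV) (X j) = measure_pmf (p j)"
  defines "H \<equiv> \<lambda>\<omega> j. if j \<in> J then X j \<omega> else d"
  shows "H \<in> measurable M (count_space UNIV)"
    and "distr M (count_space UNIV) H = measure_pmf (Pi_pmf J d p)"
proof -
  have rv[measurable]: "X j \<in> measurable M (count_space UNIV)" if "j \<in> J" for j
    using indep that by (auto simp: indep_vars_def2)
  define \<Omega> where "\<Omega> = PiE_dflt J d (\<lambda>_. UNIV :: 'b set)"
  have countable: "countable \<Omega>"
    unfolding \<Omega>_def dflt_image_PiE[symmetric] using J by (intro countable_image countable_PiE) auto
  have H_range: "H \<omega> \<in> \<Omega>" for \<omega>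
    by (auto simp: H_def \<Omega>_def PiE_dflt_def)
  have fibre: "H -` {x} \<inter> space M = {\<omega> \<in> space M. \<forall>j\<in>J. X j \<omega> = x j}" if "x \<in> \<Omega>" for x
    using that by (auto simp: H_def \<Omega>_def PiE_dflt_def fun_eq_iff)
  have fibre_sets: "H -` {x} \<inter> space M \<in> sets M" if "x \<in> \<Omega>" for x
    unfolding fibre[OF that] using J by measurable
  have "H \<in> measurable M (count_space \<Omega>)"
    using countable H_range fibre_sets by (subst measurable_count_space_eq_countable) auto
  then show H: "H \<in> measurable M (count_space UNIV)"
    by (rule measurable_compose[where g = "\<lambda>x. x"]) simp
  show "distr M (count_space UNIV) H = measure_pmf (Pi_pmf J d p)"
  proof (rule measure_eqI_countable_AE)
    show "AE x in distr M (count_space UNIV) H. x \<in> \<Omega>"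
      using H_range by (subst AE_distr_iff[OF H]) auto
    show "AE x in measure_pmf (Pi_pmf J d p). x \<in> \<Omega>"
      using set_Pi_pmf_subset[OF J, of d p] by (auto simp: AE_measure_pmf_iff \<Omega>_def PiE_dflt_def)
    fix x assume x: "x \<in> \<Omega>"
    have "prob {\<omega> \<in> space M. \<forall>j\<in>J. X j \<omega> = x j} = (\<Prod>j\<in>J. prob (X j -` {x j} \<inter> space M))"
    proof (cases "J = {}")
      case True
      then show ?thesis by (simp add: prob_space)
    next
      case False
      have "{\<omega> \<in> space M. \<forall>j\<in>J. X j \<omega> = x j} = (\<Inter>j\<in>J. X j -` {x j} \<inter> space M)"
        using False by auto
      then show ?thesis using indep_varsD_finite[OF indep False J, of "\<lambda>j. {x j}"] by simp
    qed
    also have "\<dots> = (\<Prod>j\<in>J. pmf (p j) (x j))"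
    proof (intro prod.cong refl)
      fix j assume j: "j \<in> J"
      show "prob (X j -` {x j} \<inter> space M) = pmf (p j) (x j)"
        using rv[OF j] law[OF j] measure_distr[of "X j" M "count_space UNIV" "{x j}"]
        by (simp add: pmf.rep_eq)
    qed
    also have "\<dots> = pmf (Pi_pmf J d p) x"
      using x J by (auto simp: pmf_Pi \<Omega>_def PiE_dflt_def)
    finally show "emeasure (distr M (count_space UNIV) H) {x} = emeasure (measure_pmf (Pi_pmf J d p)) {x}"
      using H by (simp add: emeasure_distr fibre[OF x] emeasure_eq_measure emeasure_pmf_single)
  qed (use countable in auto)
qed

section \<open>The iterates as a Markov chain\<close>

text \<open>
  A trajectory as a function of all the driving variables: \<open>x (t, k)\<close> is the \<open>k\<close>-th draw of step \<open>t\<close>.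
\<close>

primrec driven_path ::
    "('v \<Rightarrow> ('k \<Rightarrow> 'a) \<Rightarrow> 'v) \<Rightarrow> 'v \<Rightarrow> nat \<Rightarrow> (nat \<times> 'k \<Rightarrow> 'a) \<Rightarrow> 'v" where
  "driven_path G v\<^sub>0 0 x = v\<^sub>0"
| "driven_path G v\<^sub>0 (Suc t) x = G (driven_path G v\<^sub>0 t x) (\<lambda>k. x (t, k))"

primrec chain_law :: "('v \<Rightarrow> 'r \<Rightarrow> 'v) \<Rightarrow> 'r pmf \<Rightarrow> 'v \<Rightarrow> nat \<Rightarrow> 'v pmf" where
  "chain_law G q v\<^sub>0 0 = return_pmf v\<^sub>0"
| "chain_law G q v\<^sub>0 (Suc t) = bind_pmf (chain_law G q v\<^sub>0 t) (\<lambda>v. map_pmf (G v) q)"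

lemma finite_set_chain_law: "finite (set_pmf q) \<Longrightarrow> finite (set_pmf (chain_law G q v\<^sub>0 t))"
  by (induction t) auto

text \<open>
  The state at time \<open>t\<close> depends only on draws made before \<open>t\<close>, which is what makes it independent of
  the draws of step \<open>t\<close>.
\<close>

lemma driven_path_cong:
  assumes only_C: "\<And>v r r'. (\<And>k. k \<in> C \<Longrightarrow> r k = r' k) \<Longrightarrow> G v r = G v r'"
  shows "(\<And>s k. s < t \<Longrightarrow> k \<in> C \<Longrightarrow> x (s, k) = x' (s, k))
    \<Longrightarrow> driven_path G v\<^sub>0 t x = driven_path G v\<^sub>0 t x'"
proof (induction t)
  case (Suc t)
  have "driven_path G v\<^sub>0 t x = driven_path G v\<^sub>0 t x'" by (rule Suc.IH) (simp add: Suc.prems)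
  then show ?case using Suc.prems by (auto intro: only_C)
qed simp

text \<open>
  The product law over the steps up to \<open>t\<close> factors into the product law of the past, which
  determines the state, and that of the fresh draws of step \<open>t\<close>, which after reindexing
  is the same for all \<open>t\<close>.
\<close>

lemma map_driven_path_Pi_pmf:
  fixes G :: "'v \<Rightarrow> ('k \<Rightarrow> 'a) \<Rightarrow> 'v"
  assumes C: "finite C"
    and only_C: "\<And>v r r'. (\<And>k. k \<in> C \<Longrightarrow> r k = r' k) \<Longrightarrow> G v r = G v r'"
  shows "map_pmf (driven_path G v\<^sub>0 t) (Pi_pmf ({..<t} \<times> C) d (\<lambda>_. p))
    = chain_law G (Pi_pmf C d (\<lambda>_. p)) v\<^sub>0 t"
proof (induction t)
  case 0
  then show ?case by simp
next
  case (Suc t)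
  let ?J = "{..<t} \<times> C" and ?C = "{t} \<times> C"
  define merge :: "(nat \<times> 'k \<Rightarrow> 'a) \<times> (nat \<times> 'k \<Rightarrow> 'a) \<Rightarrow> nat \<times> 'k \<Rightarrow> 'a"
    where "merge = (\<lambda>(f, g) x. if x \<in> ?J then f x else g x)"
  have J: "{..<Suc t} \<times> C = ?J \<union> ?C" by auto
  have "Pi_pmf ({..<Suc t} \<times> C) d (\<lambda>_. p)
      = map_pmf merge (pair_pmf (Pi_pmf ?J d (\<lambda>_. p)) (Pi_pmf ?C d (\<lambda>_. p)))"
    unfolding J merge_def using C by (intro Pi_pmf_union) auto
  moreover have "driven_path G v\<^sub>0 (Suc t) \<circ> merge
      = (\<lambda>(f, g). G (driven_path G v\<^sub>0 t f) (g \<circ> Pair t))"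
  proof (intro ext, clarify)
    fix f g
    have "driven_path G v\<^sub>0 t (merge (f, g)) = driven_path G v\<^sub>0 t f"
      by (rule driven_path_cong[OF only_C]) (auto simp: merge_def)
    then show "(driven_path G v\<^sub>0 (Suc t) \<circ> merge) (f, g)
        = G (driven_path G v\<^sub>0 t f) (g \<circ> Pair t)"
      by (simp add: merge_def o_def)
  qed
  ultimately have "map_pmf (driven_path G v\<^sub>0 (Suc t)) (Pi_pmf ({..<Suc t} \<times> C) d (\<lambda>_. p))
      = map_pmf (\<lambda>(f, g). G (driven_path G v\<^sub>0 t f) (g \<circ> Pair t))
          (pair_pmf (Pi_pmf ?J d (\<lambda>_. p)) (Pi_pmf ?C d (\<lambda>_. p)))"
    by (simp only: pmf.map_comp)
  also have "\<dots> = bind_pmf (map_pmf (driven_path G v\<^sub>0 t) (Pi_pmf ?J d (\<lambda>_. p)))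
      (\<lambda>v. map_pmf (G v) (map_pmf (\<lambda>g. g \<circ> Pair t) (Pi_pmf ?C d (\<lambda>_. p))))"
    by (simp add: pair_pmf_def map_pmf_def bind_assoc_pmf bind_return_pmf)
  also have "map_pmf (\<lambda>g. g \<circ> Pair t) (Pi_pmf ?C d (\<lambda>_. p)) = Pi_pmf C d (\<lambda>_. p)"
    using C by (intro Pi_pmf_bij_betw[symmetric]) (auto simp: bij_betw_def inj_on_def)
  finally show ?case by (simp add: Suc.IH)
qed

text \<open>
  This reduces expectations over the original probability space, where conditioning on the past
  would be needed, to iterated expectations over mass functions.
\<close>

lemma (in prob_space) expectation_driven_process:
  fixes X :: "nat \<Rightarrow> 'k \<Rightarrow> 'a \<Rightarrow> 'b::countable" and z :: "nat \<Rightarrow> 'a \<Rightarrow> 'v"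
    and f :: "'v \<Rightarrow> 'w::{banach, second_countable_topology}"
  assumes C: "finite C"
    and only_C: "\<And>v r r'. (\<And>k. k \<in> C \<Longrightarrow> r k = r' k) \<Longrightarrow> G v r = G v r'"
    and indep: "indep_vars (\<lambda>_. count_space UNIV) (\<lambda>(t, k). X t k) (UNIV \<times> C)"
    and law: "\<And>t k. k \<in> C \<Longrightarrow> distr M (count_space UNIV) (X t k) = measure_pmf p"
    and init: "\<And>\<omega>. \<omega> \<in> space M \<Longrightarrow> z 0 \<omega> = v\<^sub>0"
    and step: "\<And>t \<omega>. \<omega> \<in> space M \<Longrightarrow> z (Suc t) \<omega> = G (z t \<omega>) (\<lambda>k. X t k \<omega>)"
  shows "expectation (\<lambda>\<omega>. f (z t \<omega>))
    = measure_pmf.expectation (chain_law G (Pi_pmf C d (\<lambda>_. p)) v\<^sub>0 t) f"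
proof -
  define J where "J = {..<t} \<times> C"
  define H where "H = (\<lambda>\<omega> j. if j \<in> J then (case j of (t, k) \<Rightarrow> X t k) \<omega> else d)"
  have J: "finite J" "indep_vars (\<lambda>_. count_space UNIV) (\<lambda>(t, k). X t k) J"
    using C indep_vars_subset[OF indep, of J] by (auto simp: J_def)
  have lawJ: "distr M (count_space UNIV) (case j of (t, k) \<Rightarrow> X t k) = measure_pmf p"
    if "j \<in> J" for j
    using that law by (auto simp: J_def)
  note H = distr_indep_vars_eq_Pi_pmf[OF J, where p = "\<lambda>_. p" and d = d, OF lawJ, folded H_def]
  have path: "z s \<omega> = driven_path G v\<^sub>0 s (\<lambda>(t, k). X t k \<omega>)" if "\<omega> \<in> space M" for s \<omega>
    using that by (induction s) (simp_all add: init step)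
  have z: "z t \<omega> = driven_path G v\<^sub>0 t (H \<omega>)" if "\<omega> \<in> space M" for \<omega>
    unfolding path[OF that] by (rule driven_path_cong[OF only_C]) (auto simp: H_def J_def)
  have "expectation (\<lambda>\<omega>. f (z t \<omega>)) = expectation (\<lambda>\<omega>. f (driven_path G v\<^sub>0 t (H \<omega>)))"
    by (intro Bochner_Integration.integral_cong) (simp_all add: z)
  also have "\<dots> = integral\<^sup>L (distr M (count_space UNIV) H) (\<lambda>x. f (driven_path G v\<^sub>0 t x))"
    using H(1) by (subst integral_distr) auto
  also have "\<dots> = measure_pmf.expectation
      (map_pmf (driven_path G v\<^sub>0 t) (Pi_pmf J d (\<lambda>_. p))) f"
    using H(2) by simp
  also have "map_pmf (driven_path G v\<^sub>0 t) (Pi_pmf J d (\<lambda>_. p))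
      = chain_law G (Pi_pmf C d (\<lambda>_. p)) v\<^sub>0 t"
    unfolding J_def by (rule map_driven_path_Pi_pmf[OF C only_C])
  finally show ?thesis .
qed

section \<open>Moments of the stochastic gradient\<close>

locale block_sampling =
  fixes A :: "complex ^ 'd ^ 'm" and y :: "real ^ 'm" and B :: "nat \<Rightarrow> 'm set"
    and R K :: nat and p :: "nat pmf" and \<epsilon> :: real
  assumes y_nonneg: "0 \<le> y $ i"
    and eps: "0 \<le> \<epsilon>"
    and R: "1 \<le> R"
    and K: "1 \<le> K"
    and blocks_cover: "(\<Union>r\<in>{1..R}. B r) = UNIV"
    and blocks_disjoint: "disjoint_family_on B {1..R}"
    and p_support: "set_pmf p \<subseteq> {1..R}"
    and p_pos: "r \<in> {1..R} \<Longrightarrow> 0 < pmf p r"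
begin

(* Keeps the interval {1..R} in the form in which the partition facts are stated. *)
declare One_nat_def [simp del]

abbreviation "loss \<equiv> amp_loss \<epsilon> A y"
abbreviation "loss_inf \<equiv> amp_loss_inf \<epsilon> A y"
abbreviation "grad \<equiv> wirtinger_grad \<epsilon> A y"
abbreviation "block_loss r \<equiv> amp_loss \<epsilon> (row_block (B r) A) (row_block (B r) y)"
abbreviation "block_loss_inf r \<equiv> amp_loss_inf \<epsilon> (row_block (B r) A) (row_block (B r) y)"
abbreviation "block_grad r \<equiv> wirtinger_grad \<epsilon> (row_block (B r) A) (row_block (B r) y)"
abbreviation "\<alpha> \<equiv> saf_alpha A B R p K"
abbreviation "\<beta> \<equiv> saf_beta K"
abbreviation "\<delta> \<equiv> saf_delta \<epsilon> A y B R p K"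
abbreviation "indices \<equiv> Pi_pmf {1..K} 0 (\<lambda>_. p)"

lemma finite_support: "finite (set_pmf p)"
  using p_support finite_subset by blast

lemma finite_indices: "finite (set_pmf indices)"
  using finite_support by (intro finite_set_Pi_pmf) auto

lemmas partition = finite_atLeastAtMost[of 1 R] blocks_disjoint blocks_cover

text \<open>
  Division by the probabilities cancels the weights of the expectation; hence sampling blocks with
  an arbitrary positive law gives unbiased gradients.
\<close>

lemma importance_weighted_expectation:
  fixes f :: "nat \<Rightarrow> 'v::euclidean_space"
  shows "measure_pmf.expectation p (\<lambda>r. (1 / pmf p r) *\<^sub>R f r) = (\<Sum>r\<in>{1..R}. f r)"
proof -
  have "measure_pmf.expectation p (\<lambda>r. (1 / pmf p r) *\<^sub>R f r)
      = (\<Sum>r\<in>{1..R}. pmf p r *\<^sub>R (1 / pmf p r) *\<^sub>R f r)"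
    using p_support by (intro integral_measure_pmf) auto
  also have "\<dots> = (\<Sum>r\<in>{1..R}. f r)"
    using p_pos by (intro sum.cong refl) (auto simp: less_le)
  finally show ?thesis .
qed

lemma expectation_stoch_grad:
  "measure_pmf.expectation indices (\<lambda>r. stoch_grad \<epsilon> A y B p K r z) = grad z"
  using K expectation_sum_Pi_pmf[OF finite_support, of "{1..K}" 0 "\<lambda>r. (1 / pmf p r) *\<^sub>R block_grad r z"]
  by (simp add: stoch_grad_def importance_weighted_expectation sum_wirtinger_grad_row_block[OF partition])

lemma block_norm_over_prob_le:
  assumes "r \<in> {1..R}"
  shows "(spectral_norm (row_block (B r) A))\<^sup>2 / pmf p r \<le> real K * \<alpha>"
  using K assms by (simp add: saf_alpha_def)

lemma alpha_nonneg: "0 \<le> \<alpha>"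
proof -
  have "0 \<le> (spectral_norm (row_block (B 1) A))\<^sup>2 / pmf p 1" by simp
  also have "\<dots> \<le> real K * \<alpha>" using R by (intro block_norm_over_prob_le) simp
  finally show ?thesis using K by (simp add: zero_le_mult_iff)
qed

lemma beta_nonneg: "0 \<le> \<beta>"
  using K by (simp add: saf_beta_def)

lemma delta_nonneg: "0 \<le> \<delta>"
  unfolding saf_delta_def using alpha_nonneg sum_amp_loss_inf_row_block_le[OF partition, of \<epsilon> A y]
  by (intro mult_nonneg_nonneg) auto

text \<open>
  The weights of the expectation cancel one factor \<open>pmf p r\<close> only, and the remaining
  \<open>\<parallel>A\<^sub>r\<parallel>\<^sup>2 / pmf p r\<close> is dominated by \<open>K * \<alpha>\<close>. The block excesses
  \<open>L\<^sub>r - L\<^sub>r\<^sup>i\<^sup>n\<^sup>f\<close> are measured from separate infima; measuring them from \<open>L\<^sup>i\<^sup>n\<^sup>f\<close> instead is what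
  \<open>\<delta>\<close> accounts for.
\<close>

lemma expectation_norm_square_block_grad_le:
  "measure_pmf.expectation p (\<lambda>r. (norm ((1 / pmf p r) *\<^sub>R block_grad r z))\<^sup>2)
    \<le> real K * (\<alpha> * (loss z - loss_inf) + \<delta>)"
proof -
  have "measure_pmf.expectation p (\<lambda>r. (norm ((1 / pmf p r) *\<^sub>R block_grad r z))\<^sup>2)
      = measure_pmf.expectation p (\<lambda>r. (1 / pmf p r) *\<^sub>R ((norm (block_grad r z))\<^sup>2 / pmf p r))"
    by (simp add: power_mult_distrib power2_eq_square)
  also have "\<dots> = (\<Sum>r\<in>{1..R}. (norm (block_grad r z))\<^sup>2 / pmf p r)"
    by (rule importance_weighted_expectation)
  also have "\<dots> \<le> (\<Sum>r\<in>{1..R}. real K * \<alpha> * (block_loss r z - block_loss_inf r))"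
  proof (rule sum_mono)
    fix r assume r: "r \<in> {1..R}"
    have "0 \<le> row_block (B r) y $ i" for i using y_nonneg by (simp add: row_block_def)
    then have "(norm (block_grad r z))\<^sup>2
        \<le> (spectral_norm (row_block (B r) A))\<^sup>2 * (block_loss r z - block_loss_inf r)"
      by (rule norm_wirtinger_grad_square_le[OF eps])
    then have "(norm (block_grad r z))\<^sup>2 / pmf p r
        \<le> (spectral_norm (row_block (B r) A))\<^sup>2 / pmf p r * (block_loss r z - block_loss_inf r)"
      using p_pos[OF r] by (simp add: divide_right_mono)
    also have "\<dots> \<le> real K * \<alpha> * (block_loss r z - block_loss_inf r)"
      using block_norm_over_prob_le[OF r]
      by (rule mult_right_mono) (simp add: amp_loss_inf_le)
    finally show "(norm (block_grad r z))\<^sup>2 / pmf p r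
        \<le> real K * \<alpha> * (block_loss r z - block_loss_inf r)" .
  qed
  also have "\<dots> = real K * \<alpha> * (loss z - (\<Sum>r\<in>{1..R}. block_loss_inf r))"
    by (simp add: sum_distrib_left[symmetric] sum_subtractf sum_amp_loss_row_block[OF partition])
  also have "\<dots> = real K * (\<alpha> * (loss z - loss_inf) + \<delta>)"
    by (simp add: saf_delta_def algebra_simps)
  finally show ?thesis .
qed

lemma expectation_norm_square_stoch_grad_le:
  "measure_pmf.expectation indices (\<lambda>r. (norm (stoch_grad \<epsilon> A y B p K r z))\<^sup>2)
    \<le> \<alpha> * (loss z - loss_inf) + \<delta> + \<beta> * (norm (grad z))\<^sup>2"
proof -
  let ?h = "\<lambda>r. (1 / pmf p r) *\<^sub>R block_grad r z"
  let ?V = "measure_pmf.expectation p (\<lambda>r. (norm (?h r))\<^sup>2)"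
  have K0: "real K > 0" using K by simp
  have mean: "measure_pmf.expectation p ?h = grad z"
    by (simp add: importance_weighted_expectation sum_wirtinger_grad_row_block[OF partition])
  have "measure_pmf.expectation indices (\<lambda>r. (norm (stoch_grad \<epsilon> A y B p K r z))\<^sup>2)
      = (1 / real K)\<^sup>2 * measure_pmf.expectation indices (\<lambda>r. (norm (\<Sum>k\<in>{1..K}. ?h (r k)))\<^sup>2)"
    unfolding stoch_grad_def norm_scaleR power_mult_distrib by simp
  also have "\<dots> = (1 / real K)\<^sup>2 * (real K * ?V + real K * (real K - 1) * (norm (grad z))\<^sup>2)"
    using expectation_norm_square_sum_Pi_pmf[OF finite_support, of "{1..K}" 0 ?h]
    unfolding mean by simp
  also have "\<dots> = ?V / real K + \<beta> * (norm (grad z))\<^sup>2"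
    using K0 by (simp add: saf_beta_def field_simps power2_eq_square)
  also have "?V / real K \<le> \<alpha> * (loss z - loss_inf) + \<delta>"
    using expectation_norm_square_block_grad_le[of z] K0 by (simp add: field_simps)
  finally show ?thesis by simp
qed

lemma expected_loss_after_step_le:
  "measure_pmf.expectation indices (\<lambda>r. loss (z - \<mu> *\<^sub>R stoch_grad \<epsilon> A y B p K r z))
    \<le> loss z - 2 * \<mu> * (norm (grad z))\<^sup>2 + \<mu>\<^sup>2 * (spectral_norm A)\<^sup>2
        * (\<alpha> * (loss z - loss_inf) + \<delta> + \<beta> * (norm (grad z))\<^sup>2)"
proof -
  let ?g = "\<lambda>r. stoch_grad \<epsilon> A y B p K r z"
  have I[simp]: "integrable (measure_pmf indices) f"
    for f :: "(nat \<Rightarrow> nat) \<Rightarrow> 'w::euclidean_space"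
    by (rule integrable_measure_pmf_finite[OF finite_indices])
  have "measure_pmf.expectation indices (\<lambda>r. loss (z - \<mu> *\<^sub>R ?g r))
      \<le> measure_pmf.expectation indices (\<lambda>r. loss z - 2 * \<mu> * (grad z \<bullet> ?g r)
          + \<mu>\<^sup>2 * (spectral_norm A)\<^sup>2 * (norm (?g r))\<^sup>2)"
  proof (intro integral_mono I)
    fix r
    show "loss (z - \<mu> *\<^sub>R ?g r)
        \<le> loss z - 2 * \<mu> * (grad z \<bullet> ?g r) + \<mu>\<^sup>2 * (spectral_norm A)\<^sup>2 * (norm (?g r))\<^sup>2"
      using amp_loss_descent[OF eps y_nonneg, of A z "- \<mu> *\<^sub>R ?g r"]
      by (simp add: power_mult_distrib mult_ac)
  qed
  also have "\<dots> = loss z - 2 * \<mu> * (norm (grad z))\<^sup>2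
      + \<mu>\<^sup>2 * (spectral_norm A)\<^sup>2 * measure_pmf.expectation indices (\<lambda>r. (norm (?g r))\<^sup>2)"
    by (simp add: measure_pmf.prob_space expectation_stoch_grad power2_norm_eq_inner[of "grad z"])
  also have "\<dots> \<le> loss z - 2 * \<mu> * (norm (grad z))\<^sup>2 + \<mu>\<^sup>2 * (spectral_norm A)\<^sup>2
        * (\<alpha> * (loss z - loss_inf) + \<delta> + \<beta> * (norm (grad z))\<^sup>2)"
    using expectation_norm_square_stoch_grad_le[of z] by (intro add_left_mono mult_left_mono) auto
  finally show ?thesis .
qed

section \<open>Convergence in expectation\<close>

abbreviation "iterate_law \<mu> z\<^sub>0 \<equiv>
  chain_law (\<lambda>z r. z - \<mu> *\<^sub>R stoch_grad \<epsilon> A y B p K r z) indices z\<^sub>0"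

lemma expected_excess_loss_recursion:
  fixes \<mu> :: real and z\<^sub>0 :: "complex ^ 'd"
  assumes mu: "0 < \<mu>" "\<mu> * (\<beta> * (spectral_norm A)\<^sup>2) \<le> 1"
  defines "D \<equiv> \<lambda>t. measure_pmf.expectation (iterate_law \<mu> z\<^sub>0 t) (\<lambda>z. loss z - loss_inf)"
    and "G \<equiv> \<lambda>t. measure_pmf.expectation (iterate_law \<mu> z\<^sub>0 t) (\<lambda>z. (norm (grad z))\<^sup>2)"
  shows "D (Suc t) \<le> (1 + \<mu>\<^sup>2 * \<alpha> * (spectral_norm A)\<^sup>2) * D t - \<mu> * G t
    + \<mu>\<^sup>2 * (spectral_norm A)\<^sup>2 * \<delta>"
proof -
  let ?N = "(spectral_norm A)\<^sup>2"
  let ?P = "iterate_law \<mu> z\<^sub>0 t"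
  have fin: "finite (set_pmf ?P)"
    by (rule finite_set_chain_law[OF finite_indices])
  have I[simp]: "integrable (measure_pmf ?P) f" for f :: "complex ^ 'd \<Rightarrow> real"
    by (rule integrable_measure_pmf_finite[OF fin])
  have I'[simp]: "integrable (measure_pmf indices) f" for f :: "(nat \<Rightarrow> nat) \<Rightarrow> real"
    by (rule integrable_measure_pmf_finite[OF finite_indices])
  have "D (Suc t) = measure_pmf.expectation ?P (\<lambda>z. measure_pmf.expectation indices
      (\<lambda>r. loss (z - \<mu> *\<^sub>R stoch_grad \<epsilon> A y B p K r z)) - loss_inf)"
    unfolding D_def chain_law.simps
    by (subst expectation_bind_finite) (simp_all add: fin finite_indices measure_pmf.prob_space)
  also have "\<dots> \<le> measure_pmf.expectation ?P (\<lambda>z. (1 + \<mu>\<^sup>2 * \<alpha> * ?N) * (loss z - loss_inf)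
      - \<mu> * (norm (grad z))\<^sup>2 + \<mu>\<^sup>2 * ?N * \<delta>)"
  proof (intro integral_mono I)
    fix z
    (* Half of the linear decrease 2 * \<mu> * |grad z|^2 pays for the \<beta>-term. *)
    have "\<mu> * (\<beta> * ?N) * (\<mu> * (norm (grad z))\<^sup>2) \<le> 1 * (\<mu> * (norm (grad z))\<^sup>2)"
      using mu by (intro mult_right_mono) auto
    then show "measure_pmf.expectation indices
          (\<lambda>r. loss (z - \<mu> *\<^sub>R stoch_grad \<epsilon> A y B p K r z)) - loss_inf
        \<le> (1 + \<mu>\<^sup>2 * \<alpha> * ?N) * (loss z - loss_inf) - \<mu> * (norm (grad z))\<^sup>2 + \<mu>\<^sup>2 * ?N * \<delta>"
      using expected_loss_after_step_le[of z \<mu>] by (simp add: algebra_simps power2_eq_square)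
  qed
  also have "\<dots> = (1 + \<mu>\<^sup>2 * \<alpha> * ?N) * D t - \<mu> * G t + \<mu>\<^sup>2 * ?N * \<delta>"
    unfolding D_def G_def
    by (simp add: measure_pmf.prob_space del: Bochner_Integration.integral_diff)
      (simp add: measure_pmf.prob_space)
  finally show ?thesis .
qed

end

text \<open>
  With \<open>x = a * T\<close> the claim reads \<open>1 \<le> (1 + a) ^ T * (1 - x / 2)\<close>. By Bernoulli's inequality it
  follows from \<open>(1 + x) * (1 - x / 2) = 1 + x * (1 - x) / 2 \<ge> 1\<close>.
\<close>

lemma geometric_sum_ge_half:
  fixes a :: real
  assumes "0 \<le> a" "a * real T \<le> 1"
  shows "real T / 2 * (1 + a) ^ T \<le> (\<Sum>s<T. (1 + a) ^ s)"
proof (cases "a = 0")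
  case False
  define x where "x = a * real T"
  have a: "a > 0" and x: "0 \<le> x" "x \<le> 1" using assms False by (auto simp: x_def)
  have "1 \<le> (1 + x) * (1 - x / 2)"
    using mult_nonneg_nonneg[of x "1 - x"] x by (simp add: algebra_simps)
  also have "\<dots> \<le> (1 + a) ^ T * (1 - x / 2)"
    using Bernoulli_inequality[of a T] a x by (intro mult_right_mono) (auto simp: x_def mult.commute)
  finally have "x / 2 * (1 + a) ^ T \<le> (1 + a) ^ T - 1" by (simp add: algebra_simps)
  then have "x / 2 * (1 + a) ^ T / a \<le> ((1 + a) ^ T - 1) / a"
    using a by (intro divide_right_mono) auto
  then show ?thesis using a by (simp add: geometric_sum x_def)
qed simp

text \<open>
  Unrolling the recursion and using \<open>D T \<ge> 0\<close>, the \<open>T\<close> decrements, each amplified by the later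
  growth factors, sum up to at most \<open>(1 + a) ^ T * D 0\<close>; the geometric sum is at least half of what it
  would be if every decrement were amplified \<open>T\<close> times.
\<close>

lemma perturbed_descent_rate:
  fixes D :: "nat \<Rightarrow> real"
  assumes a: "0 \<le> a" "a * real T \<le> 1" and T: "1 \<le> T"
    and D: "0 \<le> D T" "0 \<le> D 0"
    and rec: "\<And>t. t < T \<Longrightarrow> D (Suc t) \<le> (1 + a) * D t - e"
  shows "e \<le> 2 * D 0 / real T"
proof (cases "e \<le> 0")
  case True
  also have "0 \<le> 2 * D 0 / real T" using D by simp
  finally show ?thesis .
next
  case False
  have "D t \<le> (1 + a) ^ t * D 0 - e * (\<Sum>s<t. (1 + a) ^ s)" if "t \<le> T" for t
    using that
  proof (induction t)
    case (Suc t)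
    have "D (Suc t) \<le> (1 + a) * D t - e" using Suc.prems by (intro rec) simp
    also have "(1 + a) * D t \<le> (1 + a) * ((1 + a) ^ t * D 0 - e * (\<Sum>s<t. (1 + a) ^ s))"
      using Suc a by (intro mult_left_mono) auto
    also have "\<dots> - e = (1 + a) ^ Suc t * D 0 - e * (1 + (1 + a) * (\<Sum>s<t. (1 + a) ^ s))"
      by (simp add: algebra_simps)
    also have "1 + (1 + a) * (\<Sum>s<t. (1 + a) ^ s) = (\<Sum>s<Suc t. (1 + a) ^ s)"
      by (simp add: sum.lessThan_Suc_shift sum_distrib_left del: sum.lessThan_Suc)
    finally show ?case by simp
  qed simp
  from this[of T] have "e * (\<Sum>s<T. (1 + a) ^ s) \<le> (1 + a) ^ T * D 0" using D by simp
  moreover have "e * (real T / 2 * (1 + a) ^ T) \<le> e * (\<Sum>s<T. (1 + a) ^ s)"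
    using False by (intro mult_left_mono geometric_sum_ge_half a) auto
  ultimately have "(1 + a) ^ T * (e * real T / 2) \<le> (1 + a) ^ T * D 0" by (simp add: mult_ac)
  then have "e * real T / 2 \<le> D 0" using a by (subst (asm) mult_le_cancel_left_pos) auto
  then show ?thesis using T by (simp add: field_simps)
qed

text \<open>
  The three bounds on \<open>\<mu>\<close> are stated without division, which covers vanishing denominators. The
  first one gives \<open>a * T \<le> 1\<close> for the growth factor \<open>1 + a\<close>, the second lets the linear decrease
  absorb the \<open>\<beta>\<close>-term, and the third keeps the noise floor at most \<open>\<gamma>\<^sup>2 / 2\<close>.
\<close>

lemma (in block_sampling) Min_expected_grad_le:
  fixes \<mu> \<gamma> :: real and z\<^sub>0 :: "complex ^ 'd"
  assumes mu: "0 < \<mu>" and gamma: "0 < \<gamma>" and T: "1 \<le> T"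
    and T_ge: "4 * (loss z\<^sub>0 - loss_inf) / (\<gamma>\<^sup>2 * \<mu>) \<le> real T"
    and mu_alpha: "\<mu> * (sqrt (\<alpha> * real T) * spectral_norm A) \<le> 1"
    and mu_beta: "\<mu> * (\<beta> * (spectral_norm A)\<^sup>2) \<le> 1"
    and mu_delta: "\<mu> * (2 * \<delta> * (spectral_norm A)\<^sup>2) \<le> \<gamma>\<^sup>2"
  shows "(MIN t\<in>{0..T - 1}. measure_pmf.expectation (iterate_law \<mu> z\<^sub>0 t) (\<lambda>z. norm (grad z))) \<le> \<gamma>"
proof -
  let ?E = "\<lambda>t. measure_pmf.expectation (iterate_law \<mu> z\<^sub>0 t)"
  let ?N = "(spectral_norm A)\<^sup>2"
  define D where "D = (\<lambda>t. ?E t (\<lambda>z. loss z - loss_inf))"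
  define G where "G = (\<lambda>t. ?E t (\<lambda>z. (norm (grad z))\<^sup>2))"
  define m where "m = (MIN t\<in>{0..T - 1}. ?E t (\<lambda>z. norm (grad z)))"
  define a where "a = \<mu>\<^sup>2 * \<alpha> * ?N"
  have "m \<in> (\<lambda>t. ?E t (\<lambda>z. norm (grad z))) ` {0..T - 1}"
    unfolding m_def by (rule Min_in) auto
  then have m0: "0 \<le> m" by (auto intro!: Bochner_Integration.integral_nonneg)
  (* The square of a minimum of means is below every second moment: nonnegativity of the variance. *)
  have mG: "m\<^sup>2 \<le> G t" if "t < T" for t
  proof -
    have I: "integrable (measure_pmf (iterate_law \<mu> z\<^sub>0 t)) f" for f :: "complex ^ 'd \<Rightarrow> real"
      by (intro integrable_measure_pmf_finite finite_set_chain_law finite_indices)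
    have "m \<le> ?E t (\<lambda>z. norm (grad z))" unfolding m_def using that by (intro Min_le) auto
    then have "m\<^sup>2 \<le> (?E t (\<lambda>z. norm (grad z)))\<^sup>2" using m0 by (intro power_mono) auto
    also have "\<dots> \<le> G t"
      using measure_pmf.variance_eq[of "iterate_law \<mu> z\<^sub>0 t" "\<lambda>z. norm (grad z)", OF I I]
        measure_pmf.variance_positive[of "iterate_law \<mu> z\<^sub>0 t" "\<lambda>z. norm (grad z)"]
      by (simp add: G_def)
    finally show ?thesis .
  qed
  have a0: "0 \<le> a" by (simp add: a_def alpha_nonneg)
  have "(\<mu> * (sqrt (\<alpha> * real T) * spectral_norm A))\<^sup>2 \<le> 1\<^sup>2"
    using mu mu_alpha by (intro power_mono) (auto simp: alpha_nonneg spectral_norm_nonneg)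
  then have aT: "a * real T \<le> 1"
    using alpha_nonneg by (simp add: a_def power_mult_distrib mult_ac)
  have D0: "0 \<le> D t" for t
    unfolding D_def by (intro Bochner_Integration.integral_nonneg) (simp add: amp_loss_inf_le)
  have "D (Suc t) \<le> (1 + a) * D t - (\<mu> * m\<^sup>2 - \<mu>\<^sup>2 * ?N * \<delta>)" if "t < T" for t
    using expected_excess_loss_recursion[OF mu mu_beta, of z\<^sub>0 t]
      mult_left_mono[OF mG[OF that] less_imp_le[OF mu]]
    unfolding D_def G_def a_def by linarith
  then have "\<mu> * m\<^sup>2 - \<mu>\<^sup>2 * ?N * \<delta> \<le> 2 * D 0 / real T"
    by (rule perturbed_descent_rate[OF a0 aT T D0 D0])
  moreover have "2 * D 0 / real T \<le> \<mu> * \<gamma>\<^sup>2 / 2"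
    using T_ge mu gamma T by (simp add: D_def field_simps)
  moreover have "\<mu>\<^sup>2 * ?N * \<delta> \<le> \<mu> * \<gamma>\<^sup>2 / 2"
    using mult_left_mono[OF mu_delta less_imp_le[OF mu]] by (simp add: power2_eq_square mult_ac)
  ultimately have "\<mu> * m\<^sup>2 \<le> \<mu> * \<gamma>\<^sup>2" by simp
  then have "m\<^sup>2 \<le> \<gamma>\<^sup>2" using mu by simp
  then have "m \<le> \<gamma>" by (rule power2_le_imp_le) (rule less_imp_le[OF gamma])
  then show ?thesis by (simp only: m_def)
qed

section \<open>The step size condition\<close>

lemma ereal_le_divideD:
  assumes "ereal \<mu> \<le> ereal c / ereal D" "0 < c" "0 \<le> D"
  shows "\<mu> * D \<le> c"
proof (cases "D = 0")
  case False
  then show ?thesis using assms by (simp add: pos_le_divide_eq less_le)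
qed (use assms in simp)

text \<open>
  Since \<open>\<mu>\<close> is finite, equality excludes the case \<open>D = 0\<close>, where the quotient is \<open>\<infinity>\<close>.
\<close>

lemma ereal_eq_divideD:
  assumes "ereal \<mu> = ereal c / ereal D" "0 < c" "0 \<le> D"
  shows "\<mu> * D = c"
proof (cases "D = 0")
  case True
  then show ?thesis using assms by (simp add: ereal_divide_zero)
next
  case False
  then show ?thesis using assms by simp
qed

text \<open>
  The step size equals one of the three quotients, so \<open>1 / \<mu>\<close> is known. For the first quotient it
  contains \<open>sqrt T\<close>, so the requirement on \<open>T\<close> has the form \<open>c * sqrt T \<le> T\<close> and squares to
  \<open>c\<^sup>2 \<le> T\<close>; in the other two cases it is one of the lower bounds on \<open>T\<close>.
\<close>

lemma (in block_sampling) iterations_sufficient: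
  fixes \<mu> \<gamma> :: real and z\<^sub>0 :: "complex ^ 'd"
  assumes mu: "0 < \<mu>" and gamma: "0 < \<gamma>"
    and step: "ereal \<mu> = saf_step_bound \<epsilon> A y B R p K \<gamma> T"
    and T_alpha: "16 * \<alpha> * (spectral_norm A)\<^sup>2 * (loss z\<^sub>0 - loss_inf)\<^sup>2 / \<gamma> ^ 4 \<le> real T"
    and T_beta: "4 * \<beta> * (spectral_norm A)\<^sup>2 * (loss z\<^sub>0 - loss_inf) / \<gamma>\<^sup>2 \<le> real T"
    and T_delta: "8 * \<delta> * (spectral_norm A)\<^sup>2 * (loss z\<^sub>0 - loss_inf) / \<gamma> ^ 4 \<le> real T"
  shows "4 * (loss z\<^sub>0 - loss_inf) / (\<gamma>\<^sup>2 * \<mu>) \<le> real T"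
proof -
  define N where "N = spectral_norm A"
  define D where "D = loss z\<^sub>0 - loss_inf"
  have N: "0 \<le> N" and D: "0 \<le> D" by (simp_all add: N_def D_def spectral_norm_nonneg amp_loss_inf_le)
  have "saf_step_bound \<epsilon> A y B R p K \<gamma> T \<in> {ereal 1 / ereal (sqrt (\<alpha> * real T) * N),
      ereal 1 / ereal (\<beta> * N\<^sup>2), ereal (\<gamma>\<^sup>2) / ereal (2 * \<delta> * N\<^sup>2)}"
    unfolding saf_step_bound_def N_def by (rule Min_in) auto
  then consider "ereal \<mu> = ereal 1 / ereal (sqrt (\<alpha> * real T) * N)"
    | "ereal \<mu> = ereal 1 / ereal (\<beta> * N\<^sup>2)"
    | "ereal \<mu> = ereal (\<gamma>\<^sup>2) / ereal (2 * \<delta> * N\<^sup>2)"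
    unfolding step by auto
  then have "4 * D / \<gamma>\<^sup>2 \<le> real T * \<mu>"
  proof cases
    case 1
    then have eq: "\<mu> * (sqrt (\<alpha> * real T) * N) = 1"
      using N alpha_nonneg by (intro ereal_eq_divideD) auto
    define c where "c = 4 * D * sqrt \<alpha> * N / \<gamma>\<^sup>2"
    have c: "0 \<le> c" using D N alpha_nonneg by (simp add: c_def)
    have "c\<^sup>2 \<le> real T"
      using T_alpha alpha_nonneg
      by (simp add: c_def D_def[symmetric] N_def[symmetric] power_mult_distrib power_divide mult_ac)
    then have "c \<le> sqrt (real T)" by (rule real_le_rsqrt)
    then have "c * sqrt (real T) \<le> sqrt (real T) * sqrt (real T)" by (rule mult_right_mono) simp
    then have "\<mu> * (c * sqrt (real T)) \<le> \<mu> * real T" using mu by simp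
    also have "\<mu> * (c * sqrt (real T)) = \<mu> * (sqrt (\<alpha> * real T) * N) * (4 * D / \<gamma>\<^sup>2)"
      by (simp add: c_def real_sqrt_mult)
    finally show ?thesis using eq by (simp add: mult.commute)
  next
    case 2
    then have eq: "\<mu> * (\<beta> * N\<^sup>2) = 1"
      using beta_nonneg by (intro ereal_eq_divideD) auto
    have "4 * D / \<gamma>\<^sup>2 = (\<mu> * (\<beta> * N\<^sup>2)) * (4 * D / \<gamma>\<^sup>2)" using eq by simp
    also have "\<dots> = \<mu> * (4 * \<beta> * N\<^sup>2 * D / \<gamma>\<^sup>2)" by (simp add: mult_ac)
    also have "\<dots> \<le> \<mu> * real T"
      using T_beta mu by (intro mult_left_mono) (simp_all add: D_def N_def)
    finally show ?thesis by (simp add: mult.commute)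
  next
    case 3
    then have eq: "\<mu> * (2 * \<delta> * N\<^sup>2) = \<gamma>\<^sup>2"
      using delta_nonneg gamma by (intro ereal_eq_divideD) auto
    have "4 * D / \<gamma>\<^sup>2 = \<gamma>\<^sup>2 * (4 * D) / \<gamma> ^ 4"
      using gamma by (simp add: field_simps power_numeral_reduce)
    also have "\<dots> = (\<mu> * (2 * \<delta> * N\<^sup>2)) * (4 * D) / \<gamma> ^ 4" unfolding eq ..
    also have "\<dots> = \<mu> * (8 * \<delta> * N\<^sup>2 * D / \<gamma> ^ 4)" by (simp add: mult_ac)
    also have "\<dots> \<le> \<mu> * real T"
      using T_delta mu by (intro mult_left_mono) (simp_all add: D_def N_def)
    finally show ?thesis by (simp add: mult.commute)
  qed
  then have "4 * D / \<gamma>\<^sup>2 / \<mu> \<le> real T" using mu by (simp only: pos_divide_le_eq)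
  then show ?thesis by (simp add: D_def)
qed

theorem theorem3p3:
  fixes A :: "complex ^ 'd ^ 'm" and y :: "real ^ 'm"
    and B :: "nat \<Rightarrow> 'm set" and R K T :: nat
    and p :: "nat pmf" and \<epsilon> \<gamma> \<mu> :: real
    and M :: "'w measure" and idx :: "nat \<Rightarrow> nat \<Rightarrow> 'w \<Rightarrow> nat"
    and z0 :: "complex ^ 'd" and z :: "nat \<Rightarrow> 'w \<Rightarrow> complex ^ 'd"
  assumes y_nonneg: "\<And>i. 0 \<le> y $ i"
    and R: "1 \<le> R" "R \<le> CARD('m)"
    and blocks_cover: "(\<Union>r\<in>{1..R}. B r) = UNIV"
    and blocks_disjoint: "disjoint_family_on B {1..R}"
    and blocks_nonempty: "\<And>r. r \<in> {1..R} \<Longrightarrow> B r \<noteq> {}"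
    and p_support: "set_pmf p \<subseteq> {1..R}"
    and p_bounds: "\<And>r. r \<in> {1..R} \<Longrightarrow> 0 < pmf p r \<and> pmf p r < 1"
    and K: "1 \<le> K"
    and eps: "0 \<le> \<epsilon>"
    and gamma: "0 < \<gamma>"
    and mu: "0 < \<mu>"
    and T: "1 \<le> T"
    and M: "prob_space M"
    and idx_indep: "prob_space.indep_vars M (\<lambda>_. count_space UNIV)
          (\<lambda>(t, k). idx t k) (UNIV \<times> {1..K})"
    and idx_distr: "\<And>t k. k \<in> {1..K} \<Longrightarrow>
          distr M (count_space UNIV) (idx t k) = measure_pmf p"
    and z_init: "\<And>\<omega>. \<omega> \<in> space M \<Longrightarrow> z 0 \<omega> = z0"
    and z_step: "\<And>t \<omega>. \<omega> \<in> space M \<Longrightarrow>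
          z (Suc t) \<omega> = z t \<omega> - \<mu> *\<^sub>R stoch_grad \<epsilon> A y B p K (\<lambda>k. idx t k \<omega>) (z t \<omega>)"
  shows
    "(real T \<ge> 4 * (amp_loss \<epsilon> A y z0 - amp_loss_inf \<epsilon> A y) / (\<gamma>\<^sup>2 * \<mu>)
        \<and> ereal \<mu> \<le> saf_step_bound \<epsilon> A y B R p K \<gamma> T
      \<longrightarrow> (MIN t\<in>{0..T - 1}.
             prob_space.expectation M (\<lambda>\<omega>. norm (wirtinger_grad \<epsilon> A y (z t \<omega>)))) \<le> \<gamma>)
     \<and>
     (ereal \<mu> = saf_step_bound \<epsilon> A y B R p K \<gamma> T
        \<and> real T \<ge> Max
            {16 * saf_alpha A B R p K * (spectral_norm A)\<^sup>2
               * (amp_loss \<epsilon> A y z0 - amp_loss_inf \<epsilon> A y)\<^sup>2 / \<gamma> ^ 4,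
             4 * saf_beta K * (spectral_norm A)\<^sup>2
               * (amp_loss \<epsilon> A y z0 - amp_loss_inf \<epsilon> A y) / \<gamma>\<^sup>2,
             8 * saf_delta \<epsilon> A y B R p K * (spectral_norm A)\<^sup>2
               * (amp_loss \<epsilon> A y z0 - amp_loss_inf \<epsilon> A y) / \<gamma> ^ 4}
      \<longrightarrow> (MIN t\<in>{0..T - 1}.
             prob_space.expectation M (\<lambda>\<omega>. norm (wirtinger_grad \<epsilon> A y (z t \<omega>)))) \<le> \<gamma>)"
proof -
  interpret block_sampling A y B R K p \<epsilon>
    using assms by unfold_locales auto
  let ?law = "iterate_law \<mu> z0"
  have transfer: "prob_space.expectation M (\<lambda>\<omega>. norm (wirtinger_grad \<epsilon> A y (z t \<omega>)))
      = measure_pmf.expectation (?law t) (\<lambda>v. norm (grad v))" for t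
  proof (rule prob_space.expectation_driven_process[OF M _ _ idx_indep idx_distr])
    show "v - \<mu> *\<^sub>R stoch_grad \<epsilon> A y B p K r v = v - \<mu> *\<^sub>R stoch_grad \<epsilon> A y B p K r' v"
      if "\<And>k. k \<in> {1..K} \<Longrightarrow> r k = r' k" for v r r'
      using that by (simp add: stoch_grad_def)
  qed (simp_all add: z_init z_step)
  have first: "(MIN t\<in>{0..T - 1}.
        prob_space.expectation M (\<lambda>\<omega>. norm (wirtinger_grad \<epsilon> A y (z t \<omega>)))) \<le> \<gamma>"
    if iterations: "4 * (loss z0 - loss_inf) / (\<gamma>\<^sup>2 * \<mu>) \<le> real T"
      and step: "ereal \<mu> \<le> saf_step_bound \<epsilon> A y B R p K \<gamma> T"
  proof -
    have bounds: "ereal \<mu> \<le> ereal 1 / ereal (sqrt (\<alpha> * real T) * spectral_norm A)"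
      "ereal \<mu> \<le> ereal 1 / ereal (\<beta> * (spectral_norm A)\<^sup>2)"
      "ereal \<mu> \<le> ereal (\<gamma>\<^sup>2) / ereal (2 * \<delta> * (spectral_norm A)\<^sup>2)"
      by (rule order_trans[OF step[unfolded saf_step_bound_def] Min_le]; blast)+
    have "\<mu> * (sqrt (\<alpha> * real T) * spectral_norm A) \<le> 1"
      by (rule ereal_le_divideD[OF bounds(1)]) (simp_all add: alpha_nonneg spectral_norm_nonneg)
    moreover have "\<mu> * (\<beta> * (spectral_norm A)\<^sup>2) \<le> 1"
      by (rule ereal_le_divideD[OF bounds(2)]) (simp_all add: beta_nonneg)
    moreover have "\<mu> * (2 * \<delta> * (spectral_norm A)\<^sup>2) \<le> \<gamma>\<^sup>2"
      by (rule ereal_le_divideD[OF bounds(3)]) (use gamma delta_nonneg in simp_all)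
    ultimately show ?thesis
      unfolding transfer by (rule Min_expected_grad_le[OF mu gamma T iterations])
  qed
  show ?thesis
    using first iterations_sufficient[OF mu gamma, of T z0] by auto
qed

end
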